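(* Let $\mathbb{F}$ be a field with $\operatorname{char}(\mathbb{F}) \neq 0$. Then there is a family of polynomials $(f_n)_{n \in \mathbb{N}}$ with $f_n \in \mathbb{F}[x_1,\ldots,x_n]$ (so $f_n$ has at most $n$ variables) such that for every function $k=k(n)$ with $k(n) = o(n)$, for all sufficiently large $n$, the polynomial $f_n$ is not in $\overline{\Sigma^{[k]}\Pi\Sigma}$.
   Context: A polynomial $f \in \mathbb{F}[x_1,\ldots,x_n]$ is in $\overline{\Sigma^{[k]}\Pi\Sigma}$ if there exist integers $m_1,\ldots,m_k \ge 0$, affine polynomials $f_j^{(i)} \in \mathbb{F}(\epsilon)[x_1,\ldots,x_n]$ (total degree at most $1$; $1 \le i \le k$, $1 \le j \le m_i$), constants $c_1,\ldots,c_k \in \mathbb{F}(\epsilon)$, an integer $N \ge 0$ and $Q \in \mathbb{F}[x_1,\ldots,x_n,\epsilon]$ such that $\sum_{i=1}^k c_i \prod_{j=1}^{m_i} f_j^{(i)} = \epsilon^N f + \epsilon^{N+1} Q$. Here $\epsilon$ is a new variable and $\mathbb{F}(\epsilon)$ is the field of rational functions in $\epsilon$. *)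

theory Defs
  imports
    "HOL-Library.Poly_Mapping"
    "HOL-Library.Landau_Symbols"
    "HOL-Computational_Algebra.Computational_Algebra"
begin

text \<open>
  A polynomial with coefficients in \<open>'a\<close> is a finitely supported map from monomials
  to coefficients, and a monomial is a finitely supported map from variable indices to exponents.
  Variables are indexed by all of \<^typ>\<open>nat\<close>; membership in \<open>mpolys n\<close> restricts to
  \<open>x\<^sub>1, \<dots>, x\<^sub>n\<close>. Addition and multiplication are those of \<^theory>\<open>HOL-Library.Poly_Mapping\<close>.
\<close>

type_synonym 'a mpoly = "(nat \<Rightarrow>\<^sub>0 nat) \<Rightarrow>\<^sub>0 'a"

definition mpolys :: "nat \<Rightarrow> 'a::zero mpoly set" where
  "mpolys n = {p. \<forall>m\<in>Poly_Mapping.keys p. Poly_Mapping.keys m \<subseteq> {1..n}}"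

definition monom_degree :: "(nat \<Rightarrow>\<^sub>0 nat) \<Rightarrow> nat" where
  "monom_degree m = (\<Sum>i\<in>Poly_Mapping.keys m. Poly_Mapping.lookup m i)"

definition affine_mpolys :: "nat \<Rightarrow> 'a::zero mpoly set" where
  "affine_mpolys n = {p \<in> mpolys n. \<forall>m\<in>Poly_Mapping.keys p. monom_degree m \<le> 1}"

definition const_mpoly :: "'a::zero \<Rightarrow> 'a mpoly" where
  "const_mpoly c = Poly_Mapping.single 0 c"

text \<open>
  The field of rational functions in \<open>\<epsilon>\<close> over a field \<open>'a\<close> is the fraction field
  \<^typ>\<open>'a poly fract\<close>; the polynomial variable of \<^typ>\<open>'a poly\<close> plays the role of \<open>\<epsilon>\<close>.
\<close>

definition ratfun_eps :: "'a::field poly fract" where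
  "ratfun_eps = to_fract [:0, 1:]"

text \<open>
  Polynomials in \<open>x\<^sub>1, \<dots>, x\<^sub>n, \<epsilon>\<close> over \<open>'a\<close> are represented as polynomials in
  \<open>x\<^sub>1, \<dots>, x\<^sub>n\<close> with coefficients in \<^typ>\<open>'a poly\<close>. The next two maps are the coefficientwise
  inclusions of these, and of the polynomials over \<open>'a\<close>, into the polynomials over the
  rational functions in \<open>\<epsilon>\<close>.
\<close>

definition embed_eps :: "'a::field poly mpoly \<Rightarrow> 'a poly fract mpoly" where
  "embed_eps Q = Poly_Mapping.map to_fract Q"

definition embed_base :: "'a::field mpoly \<Rightarrow> 'a poly fract mpoly" where
  "embed_base f = Poly_Mapping.map (\<lambda>a. to_fract [:a:]) f"

definition border_SPS :: "nat \<Rightarrow> nat \<Rightarrow> 'a::field mpoly set" where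
  "border_SPS k n = {f \<in> mpolys n.
     \<exists>(m :: nat \<Rightarrow> nat) (l :: nat \<Rightarrow> nat \<Rightarrow> 'a poly fract mpoly) (c :: nat \<Rightarrow> 'a poly fract)
       (N :: nat) (Q :: 'a poly mpoly).
       (\<forall>i\<in>{1..k}. \<forall>j\<in>{1..m i}. l i j \<in> affine_mpolys n) \<and>
       Q \<in> mpolys n \<and>
       (\<Sum>i=1..k. const_mpoly (c i) * (\<Prod>j=1..m i. l i j)) =
         const_mpoly (ratfun_eps ^ N) * embed_base f
         + const_mpoly (ratfun_eps ^ (N + 1)) * embed_eps Q}"

end

(*
The polynomial is f = sum of z_i * z'_j * y^T(i,j), over w^2 pairs (i, j), with distinct multilinear
monomials y^T(i,j) in a logarithmic number v of variables y. Consider a product of affine polynomials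
a + b z_i + c z'_j + ..., where a is affine in y. Up to a common factor W, the coefficient of z_i z'_j
in the product is a combination of the 1 / (a a') over pairs of factors. In characteristic p > 0 we have
1 / a = a^(p-1) / a^p, and a^p is a polynomial in the p-th powers y^p. So over the field of fractions of
F(eps)[y^p] the coefficients of all pairs (i, j) lie in the span of W times the monomials of degree at
most 2 (p - 1) in y. A sum of k products therefore produces at most k (v + 1)^(2p - 2) independent
coefficients, whereas the y^T(i,j) are independent over this field, and they remain so after a
perturbation divisible by eps. Hence w^2 <= k (v + 1)^(2p - 2), which excludes k <= n for large n.
*)
theory Submission
  imports Defs "HOL-Real_Asymp.Real_Asymp"
begin

section \<open>Dependence over a subring\<close>

locale domain_subring =
  fixes S :: "'r::idom set"
  assumes zero_mem [simp]: "0 \<in> S" and one_mem [simp]: "1 \<in> S"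
    and add_mem: "a \<in> S \<Longrightarrow> b \<in> S \<Longrightarrow> a + b \<in> S"
    and mult_mem: "a \<in> S \<Longrightarrow> b \<in> S \<Longrightarrow> a * b \<in> S"
    and uminus_mem: "a \<in> S \<Longrightarrow> - a \<in> S"
begin

lemma sum_mem: "(\<And>i. i \<in> I \<Longrightarrow> f i \<in> S) \<Longrightarrow> sum f I \<in> S"
  by (induction I rule: infinite_finite_induct) (auto intro: add_mem)

lemma prod_mem: "(\<And>i. i \<in> I \<Longrightarrow> f i \<in> S) \<Longrightarrow> prod f I \<in> S"
  by (induction I rule: infinite_finite_induct) (auto intro: mult_mem)

lemma power_mem: "a \<in> S \<Longrightarrow> a ^ n \<in> S"
  by (induction n) (auto intro: mult_mem)

text \<open>The trace on the ambient domain of a span over the fraction field of \<open>S\<close>.\<close>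

inductive_set fspan :: "'r set \<Rightarrow> 'r set" for U where
  base: "u \<in> U \<Longrightarrow> u \<in> fspan U"
| zero: "0 \<in> fspan U"
| add: "x \<in> fspan U \<Longrightarrow> y \<in> fspan U \<Longrightarrow> x + y \<in> fspan U"
| scale: "s \<in> S \<Longrightarrow> x \<in> fspan U \<Longrightarrow> s * x \<in> fspan U"
| cancel: "d \<in> S \<Longrightarrow> d \<noteq> 0 \<Longrightarrow> d * x \<in> fspan U \<Longrightarrow> x \<in> fspan U"

lemma fspan_uminus: "x \<in> fspan U \<Longrightarrow> - x \<in> fspan U"
  using scale[of "- 1" x U] uminus_mem[OF one_mem] by simp

lemma fspan_diff: "x \<in> fspan U \<Longrightarrow> y \<in> fspan U \<Longrightarrow> x - y \<in> fspan U"
  using add[of x U "- y"] fspan_uminus[of y U] by simp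

lemma fspan_sum: "(\<And>i. i \<in> I \<Longrightarrow> f i \<in> fspan U) \<Longrightarrow> sum f I \<in> fspan U"
  by (induction I rule: infinite_finite_induct) (auto intro: zero add)

lemma fspan_trans: "x \<in> fspan U \<Longrightarrow> U \<subseteq> fspan V \<Longrightarrow> x \<in> fspan V"
  by (induction rule: fspan.induct) (auto intro: fspan.intros)

lemma fspan_mono: "x \<in> fspan U \<Longrightarrow> U \<subseteq> V \<Longrightarrow> x \<in> fspan V"
  by (rule fspan_trans) (auto intro: base)

text \<open>\<open>r\<close> need not lie in \<open>S\<close>: multiplication by any ring element is
  linear over the fraction field of \<open>S\<close>.\<close>

lemma fspan_mult: 
  assumes "x \<in> fspan U"
  shows "r * x \<in> fspan ((*) r ` U)"
  using assms
proof (induction rule: fspan.induct)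
  case (cancel d x)
  then show ?case
    by (metis fspan.cancel mult.left_commute)
next
  case (scale s x)
  then show ?case
    by (metis fspan.scale mult.left_commute)
qed (auto intro: fspan.intros simp: distrib_left)

lemma fspan_empty: "x \<in> fspan {} \<Longrightarrow> x = 0"
  by (induction rule: fspan.induct) auto

text \<open>Over the fraction field, \<open>x\<close> is \<open>c / d\<close> times \<open>u\<close>
  plus an element of the span of \<open>U\<close>; this is the form with the denominator multiplied
  out. In the induction a sum takes the product of both denominators, and \<open>cancel\<close>
  absorbs its divisor into \<open>d\<close>.\<close>

lemma fspan_insert:
  assumes "x \<in> fspan (insert u U)"
  shows "\<exists>d\<in>S. d \<noteq> 0 \<and> (\<exists>c\<in>S. d * x - c * u \<in> fspan U)"
  using assms
proof (induction rule: fspan.induct)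
  case (base v)
  show ?case
  proof (cases "v = u")
    case True
    then show ?thesis
      by (intro bexI[of _ 1] conjI) (auto intro: zero)
  next
    case False
    with base show ?thesis
      by (intro bexI[of _ 1] conjI bexI[of _ 0]) (auto intro: fspan.base)
  qed
next
  case zero
  then show ?case
    by (intro bexI[of _ 1] conjI bexI[of _ 0]) (auto intro: fspan.zero)
next
  case (add x y)
  then obtain d c d' c' where *: "d \<in> S" "d \<noteq> 0" "c \<in> S" "d * x - c * u \<in> fspan U"
    "d' \<in> S" "d' \<noteq> 0" "c' \<in> S" "d' * y - c' * u \<in> fspan U"
    by blast
  have "d' * (d * x - c * u) + d * (d' * y - c' * u) \<in> fspan U"
    using * by (intro fspan.add fspan.scale) auto
  then have "d * d' * (x + y) - (d' * c + d * c') * u \<in> fspan U"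
    by (simp add: algebra_simps)
  with * show ?case
    by (intro bexI[of _ "d * d'"] conjI bexI[of _ "d' * c + d * c'"]) (auto intro: add_mem mult_mem)
next
  case (scale s x)
  then obtain d c where *: "d \<in> S" "d \<noteq> 0" "c \<in> S" "d * x - c * u \<in> fspan U"
    by blast
  have "s * (d * x - c * u) \<in> fspan U"
    using * scale by (intro fspan.scale) auto
  then have "d * (s * x) - (s * c) * u \<in> fspan U"
    by (simp add: algebra_simps)
  with * scale show ?case
    by (intro bexI[of _ d] conjI bexI[of _ "s * c"]) (auto intro: mult_mem)
next
  case (cancel e x)
  then obtain d c where *: "d \<in> S" "d \<noteq> 0" "c \<in> S" "d * (e * x) - c * u \<in> fspan U"
    by blast
  with cancel show ?case
    by (intro bexI[of _ "d * e"] conjI bexI[of _ c]) (auto intro: mult_mem simp: mult.assoc)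
qed

text \<open>Fraction-free Gaussian elimination: each generator \<open>u\<close> is eliminated at the
  price of at most one vector, the pivot \<open>V k\<close>, so a surplus of vectors survives down
  to the empty generating set.\<close>

lemma exists_dependence:
  assumes "finite U" "finite I" "card U < card I" "\<And>i. i \<in> I \<Longrightarrow> V i \<in> fspan U"
  shows "\<exists>g. (\<forall>i\<in>I. g i \<in> S) \<and> (\<exists>i\<in>I. g i \<noteq> 0) \<and> (\<Sum>i\<in>I. g i * V i) = 0"
  using assms
proof (induction U arbitrary: I V rule: finite_induct)
  case empty
  then obtain i where "i \<in> I"
    by (metis card.empty ex_in_conv less_irrefl)
  \<comment> \<open>All \<open>V i\<close> vanish here, so coefficients 1 give a relation,
    nontrivial because \<open>I\<close> is nonempty.\<close>
  with empty show ?case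
    by (intro exI[of _ "\<lambda>_. 1"]) (auto intro!: sum.neutral dest: fspan_empty)
next
  case (insert u U)
  define good where "good i d c \<longleftrightarrow> d \<in> S \<and> d \<noteq> 0 \<and> c \<in> S \<and> d * V i - c * u \<in> fspan U" for i d c
  have "\<exists>q. good i (fst q) (snd q)" if i: "i \<in> I" for i
  proof -
    have "V i \<in> fspan (insert u U)"
      using insert.prems i by simp
    from fspan_insert[OF this] show ?thesis
      by (auto simp: good_def)
  qed
  then have "\<exists>q. \<forall>i\<in>I. good i (fst (q i)) (snd (q i))"
    by (intro bchoice) simp
  then obtain q where "\<And>i. i \<in> I \<Longrightarrow> good i (fst (q i)) (snd (q i))"
    by blast
  moreover define d c where "d i = fst (q i)" and "c i = snd (q i)" for i
  ultimately have good: "good i (d i) (c i)" if "i \<in> I" for i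
    using that by simp
  have dc: "d i \<in> S" "d i \<noteq> 0" "c i \<in> S" "d i * V i - c i * u \<in> fspan U" if "i \<in> I" for i
    using good[OF that] by (simp_all add: good_def)
  show ?case
  proof (cases "\<forall>i\<in>I. c i = 0")
    case True
    then have "V i \<in> fspan U" if "i \<in> I" for i
      using dc[OF that] that by (metis diff_zero fspan.cancel mult_zero_left)
    moreover have "card U < card I"
      using insert.prems(2) insert.hyps by simp
    ultimately show ?thesis
      using insert.IH[OF insert.prems(1)] by blast
  next
    case False
    then obtain k where k: "k \<in> I" "c k \<noteq> 0"
      by blast
    define I' where "I' = I - {k}"
    have I: "I = insert k I'" "k \<notin> I'" "finite I'" "card U < card I'"
      using k insert.prems(1,2) insert.hyps by (auto simp: I'_def)
    \<comment> \<open>Cross-multiplication with the pivot cancels \<open>u\<close>, which leaves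
      \<open>V' i\<close> in the span of \<open>U\<close> alone.\<close>
    define V' where "V' i = c k * d i * V i - c i * d k * V k" for i
    have "V' i \<in> fspan U" if "i \<in> I'" for i
    proof -
      have i: "i \<in> I"
        using that I by auto
      have "c k * (d i * V i - c i * u) - c i * (d k * V k - c k * u) \<in> fspan U"
        using dc i k by (blast intro: fspan_diff fspan.scale)
      then show ?thesis
        by (simp add: V'_def algebra_simps)
    qed
    then obtain g j where g: "\<And>i. i \<in> I' \<Longrightarrow> g i \<in> S" "j \<in> I'" "g j \<noteq> 0" "(\<Sum>i\<in>I'. g i * V' i) = 0"
      using insert.IH[OF I(3,4)] by metis
    \<comment> \<open>The relation among the \<open>V' i\<close>, rewritten for the
      \<open>V i\<close>: the pivot collects all its negated contributions. It stays nontrivial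
      because \<open>g j\<close>, \<open>c k\<close> and \<open>d j\<close> are nonzero in a
      domain.\<close>
    define h where "h i = (if i = k then - (\<Sum>i\<in>I'. g i * c i * d k) else g i * c k * d i)" for i
    have "(\<Sum>i\<in>I. h i * V i) = h k * V k + (\<Sum>i\<in>I'. g i * c k * d i * V i)"
      using I by (auto simp: h_def intro!: sum.cong)
    also have "\<dots> = (\<Sum>i\<in>I'. g i * V' i)"
      by (simp add: h_def V'_def sum_distrib_left sum_subtractf algebra_simps)
    finally have "(\<Sum>i\<in>I. h i * V i) = 0"
      using g by simp
    moreover have "h i \<in> S" if "i \<in> I" for i
      using that I g dc k by (auto simp: h_def intro!: uminus_mem sum_mem mult_mem)
    moreover have "h j \<noteq> 0" "j \<in> I"
      using g I k dc by (auto simp: h_def)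
    ultimately show ?thesis
      using \<open>(\<Sum>i\<in>I. h i * V i) = 0\<close> by (intro exI[of _ h]) auto
  qed
qed

end

section \<open>Substitution in polynomials\<close>

lemma sum_single_lookup: "(\<Sum>m\<in>Poly_Mapping.keys p. Poly_Mapping.single m (Poly_Mapping.lookup p m)) = p"
proof (rule poly_mapping_eqI)
  fix k
  have "Poly_Mapping.lookup (\<Sum>m\<in>Poly_Mapping.keys p. Poly_Mapping.single m (Poly_Mapping.lookup p m)) k
      = (\<Sum>m\<in>Poly_Mapping.keys p. if m = k then Poly_Mapping.lookup p m else 0)"
    by (simp add: lookup_sum lookup_single when_def)
  also have "\<dots> = Poly_Mapping.lookup p k"
    by (simp add: in_keys_iff)
  finally show "Poly_Mapping.lookup (\<Sum>m\<in>Poly_Mapping.keys p. Poly_Mapping.single m (Poly_Mapping.lookup p m)) k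
      = Poly_Mapping.lookup p k" .
qed

definition monom_value :: "(nat \<Rightarrow> 'c::comm_ring_1) \<Rightarrow> (nat \<Rightarrow>\<^sub>0 nat) \<Rightarrow> 'c" where
  "monom_value g m = (\<Prod>i\<in>Poly_Mapping.keys m. g i ^ Poly_Mapping.lookup m i)"

lemma monom_value_superset:
  assumes "finite A" "Poly_Mapping.keys m \<subseteq> A"
  shows "monom_value g m = (\<Prod>i\<in>A. g i ^ Poly_Mapping.lookup m i)"
  unfolding monom_value_def
  using assms by (intro prod.mono_neutral_left) (auto simp: in_keys_iff)

lemma monom_value_0 [simp]: "monom_value g 0 = 1"
  by (simp add: monom_value_def)

lemma monom_value_single [simp]: "monom_value g (Poly_Mapping.single i e) = g i ^ e"
  by (cases "e = 0") (auto simp: monom_value_def)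

lemma monom_value_add: "monom_value g (m + m') = monom_value g m * monom_value g m'"
proof -
  let ?A = "Poly_Mapping.keys m \<union> Poly_Mapping.keys m'"
  have "monom_value g x = (\<Prod>i\<in>?A. g i ^ Poly_Mapping.lookup x i)" if "x \<in> {m, m', m + m'}" for x
    using that Poly_Mapping.keys_add[of m m'] by (intro monom_value_superset) auto
  then show ?thesis
    by (simp add: lookup_add power_add prod.distrib)
qed

lemma monom_value_sum: "monom_value g (sum f A) = (\<Prod>a\<in>A. monom_value g (f a))"
  by (induction A rule: infinite_finite_induct) (auto simp: monom_value_add)

text \<open>The universal property of the polynomial ring: a ring homomorphism \<open>c\<close> on
  coefficients and values \<open>g\<close> of the variables extend to a ring homomorphism. The
  target is a different ring because it will be a ring of nested polynomials.\<close>

locale mpoly_subst =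
  fixes c :: "'b::comm_ring_1 \<Rightarrow> 'c::comm_ring_1" and g :: "nat \<Rightarrow> 'c"
  assumes c_0: "c 0 = 0" and c_1: "c 1 = 1"
    and c_add: "c (a + b) = c a + c b" and c_mult: "c (a * b) = c a * c b"
begin

definition subst :: "'b mpoly \<Rightarrow> 'c" where
  "subst p = (\<Sum>m\<in>Poly_Mapping.keys p. c (Poly_Mapping.lookup p m) * monom_value g m)"

lemma subst_0 [simp]: "subst 0 = 0"
  by (simp add: subst_def)

lemma subst_single: "subst (Poly_Mapping.single m a) = c a * monom_value g m"
  by (cases "a = 0") (auto simp: subst_def c_0)

lemma subst_add: "subst (p + q) = subst p + subst q"
  unfolding subst_def by (rule setsum_keys_plus_distrib) (auto simp: c_0 c_add distrib_right)

lemma subst_sum: "subst (sum f A) = (\<Sum>a\<in>A. subst (f a))"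
  by (induction A rule: infinite_finite_induct) (auto simp: subst_add)

lemma subst_mult: "subst (p * q) = subst p * subst q"
proof -
  let ?l = Poly_Mapping.lookup and ?s = Poly_Mapping.single and ?k = Poly_Mapping.keys
  have "p * q = (\<Sum>m\<in>?k p. ?s m (?l p m)) * (\<Sum>m\<in>?k q. ?s m (?l q m))"
    by (simp add: sum_single_lookup)
  also have "\<dots> = (\<Sum>m\<in>?k p. \<Sum>m'\<in>?k q. ?s (m + m') (?l p m * ?l q m'))"
    by (simp add: sum_product mult_single)
  finally have "subst (p * q) = (\<Sum>m\<in>?k p. \<Sum>m'\<in>?k q. subst (?s (m + m') (?l p m * ?l q m')))"
    by (simp add: subst_sum)
  also have "\<dots> = (\<Sum>m\<in>?k p. \<Sum>m'\<in>?k q.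
      (c (?l p m) * monom_value g m) * (c (?l q m') * monom_value g m'))"
    by (simp only: subst_single c_mult monom_value_add mult_ac)
  also have "\<dots> = subst p * subst q"
    by (simp only: subst_def sum_product)
  finally show ?thesis .
qed

lemma subst_1: "subst 1 = 1"
  using subst_single[of 0 1] by (simp add: c_1)

lemma subst_prod: "subst (prod f A) = (\<Prod>a\<in>A. subst (f a))"
  by (induction A rule: infinite_finite_induct) (auto simp: subst_mult subst_1)

lemma subst_const: "subst (const_mpoly a) = c a"
  by (simp add: const_mpoly_def subst_single)

end

lemma const_mpoly_0 [simp]: "const_mpoly 0 = 0"
  by (simp add: const_mpoly_def)

lemma const_mpoly_1 [simp]: "const_mpoly (1::'b::comm_ring_1) = 1"
  by (simp add: const_mpoly_def)

lemma const_mpoly_add: "const_mpoly (a + b) = const_mpoly a + const_mpoly b"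
  by (simp add: const_mpoly_def single_add)

lemma const_mpoly_mult: "const_mpoly (a * b) = const_mpoly a * const_mpoly b"
  by (simp add: const_mpoly_def mult_single)

lemma lookup_const_mult: "Poly_Mapping.lookup (const_mpoly a * q) m = a * Poly_Mapping.lookup q m"
  for a :: "'b::comm_ring_1"
proof -
  have "const_mpoly a * q = (\<Sum>k\<in>Poly_Mapping.keys q. Poly_Mapping.single k (a * Poly_Mapping.lookup q k))"
    by (subst sum_single_lookup[of q, symmetric], simp only: sum_distrib_left)
      (simp add: const_mpoly_def mult_single)
  then have "Poly_Mapping.lookup (const_mpoly a * q) m
      = (\<Sum>k\<in>Poly_Mapping.keys q. if k = m then a * Poly_Mapping.lookup q k else 0)"
    by (simp add: lookup_sum lookup_single when_def)
  also have "\<dots> = a * Poly_Mapping.lookup q m"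
    by (simp add: in_keys_iff)
  finally show ?thesis .
qed

lemma CHAR_poly_mapping: "CHAR('b::comm_ring_1 mpoly) = CHAR('b)"
proof (rule CHAR_eqI)
  show "of_nat CHAR('b) = (0::'b mpoly)"
    by (simp flip: single_of_nat)
  show "CHAR('b) dvd n" if "of_nat n = (0::'b mpoly)" for n
    using that by (metis lookup_of_nat lookup_zero of_nat_eq_0_iff_char_dvd single_of_nat lookup_single_eq)
qed

lemma monom_degree_le_1:
  assumes "monom_degree m \<le> 1"
  shows "m = 0 \<or> (\<exists>a. m = Poly_Mapping.single a 1)"
proof (cases "m = 0")
  case False
  then obtain a where a: "a \<in> Poly_Mapping.keys m"
    by (metis ex_in_conv keys_eq_empty)
  have "monom_degree m = Poly_Mapping.lookup m a + (\<Sum>i\<in>Poly_Mapping.keys m - {a}. Poly_Mapping.lookup m i)"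
    unfolding monom_degree_def using a by (simp add: sum.remove)
  moreover have "Poly_Mapping.lookup m a \<ge> 1"
    using a by (simp add: in_keys_iff)
  ultimately have "Poly_Mapping.lookup m a = 1" "(\<Sum>i\<in>Poly_Mapping.keys m - {a}. Poly_Mapping.lookup m i) = 0"
    using assms by linarith+
  then have "Poly_Mapping.lookup m a = 1" "Poly_Mapping.lookup m i = 0" if "i \<noteq> a" for i
    using that by (auto simp: in_keys_iff)
  then have "m = Poly_Mapping.single a 1"
    by (intro poly_mapping_eqI) (metis lookup_single_eq lookup_single_not_eq)
  then show ?thesis by blast
qed auto

section \<open>Products of affine polynomials\<close>

text \<open>The ring of polynomials in the p-th powers of the variables. Coefficients are arbitrary,
  so all constants are scalars; in characteristic \<open>p\<close> so are the p-th powers of affine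
  polynomials.\<close>

definition pth_exponents :: "nat \<Rightarrow> 'b::zero mpoly set" where
  "pth_exponents p = {q. \<forall>m\<in>Poly_Mapping.keys q. \<forall>i. p dvd Poly_Mapping.lookup m i}"

lemma domain_subring_pth_exponents: "domain_subring (pth_exponents p :: 'b::idom mpoly set)"
proof
  fix a b :: "'b mpoly"
  assume "a \<in> pth_exponents p" "b \<in> pth_exponents p"
  then have ab: "\<And>m i. m \<in> Poly_Mapping.keys a \<union> Poly_Mapping.keys b \<Longrightarrow> p dvd Poly_Mapping.lookup m i"
    by (auto simp: pth_exponents_def)
  show "a + b \<in> pth_exponents p"
    using ab Poly_Mapping.keys_add[of a b] by (auto simp: pth_exponents_def)
  show "a * b \<in> pth_exponents p"
    unfolding pth_exponents_def
  proof (intro CollectI ballI allI)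
    fix m i
    assume "m \<in> Poly_Mapping.keys (a * b)"
    then obtain m1 m2 where "m = m1 + m2" "m1 \<in> Poly_Mapping.keys a" "m2 \<in> Poly_Mapping.keys b"
      using keys_mult[of a b] by blast
    then show "p dvd Poly_Mapping.lookup m i"
      using ab by (simp add: lookup_add)
  qed
qed (auto simp: pth_exponents_def)

lemma const_in_pth_exponents: "const_mpoly a \<in> pth_exponents p"
  by (simp add: const_mpoly_def pth_exponents_def)

text \<open>The outer polynomial variable will stand for z and the inner one for z', so this is the
  coefficient of z^r z'^s.\<close>

abbreviation coeff2 :: "'r::comm_ring_1 poly poly \<Rightarrow> nat \<Rightarrow> nat \<Rightarrow> 'r" where
  "coeff2 x r s \<equiv> coeff (coeff x r) s"

text \<open>Modulo z^2 and z'^2 these four coefficients determine each other under multiplication,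
  so no higher ones have to be tracked.\<close>

lemma coeff2_mult:
  "coeff2 (x * y) 0 0 = coeff2 x 0 0 * coeff2 y 0 0"
  "coeff2 (x * y) 1 0 = coeff2 x 0 0 * coeff2 y 1 0 + coeff2 x 1 0 * coeff2 y 0 0"
  "coeff2 (x * y) 0 1 = coeff2 x 0 0 * coeff2 y 0 1 + coeff2 x 0 1 * coeff2 y 0 0"
  "coeff2 (x * y) 1 1 = coeff2 x 0 0 * coeff2 y 1 1 + coeff2 x 0 1 * coeff2 y 1 0
     + coeff2 x 1 0 * coeff2 y 0 1 + coeff2 x 1 1 * coeff2 y 0 0"
  by (simp_all add: coeff_mult coeff_sum algebra_simps)

text \<open>When \<open>B\<close> consists of 1 and some variables, these are the monomials of
  degree at most \<open>d\<close> in them.\<close>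

primrec products :: "'r::comm_monoid_mult set \<Rightarrow> nat \<Rightarrow> 'r set" where
  "products B 0 = {1}"
| "products B (Suc d) = (\<lambda>(u, t). u * t) ` (products B d \<times> B)"

lemma finite_products: "finite B \<Longrightarrow> finite (products B d)"
  by (induction d) auto

text \<open>Counting ordered factors is crude, but a bound polynomial in \<open>card B\<close> is
  enough for a logarithmic number of variables.\<close>

lemma card_products: "finite B \<Longrightarrow> card (products B d) \<le> card B ^ d"
proof (induction d)
  case (Suc d)
  have "card (products B (Suc d)) \<le> card (products B d \<times> B)"
    unfolding products.simps using Suc.prems by (intro card_image_le finite_cartesian_product finite_products)
  also have "\<dots> \<le> card B ^ d * card B"
    using Suc by (simp add: card_cartesian_product)
  finally show ?case by (simp add: mult.commute)
qed auto

lemma products_mono: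
  assumes "1 \<in> B" "d \<le> e"
  shows "products B d \<subseteq> products B e"
  using assms(2)
proof (induction e rule: dec_induct)
  case (step e)
  have "u \<in> products B (Suc e)" if "u \<in> products B e" for u
    using imageI[of "(u, 1)" "products B e \<times> B" "\<lambda>(u, t). u * t"] that assms(1) by simp
  with step show ?case by blast
qed auto

section \<open>The low-order coefficients of a product of affine factors\<close>

context domain_subring
begin

text \<open>Described by the action on spans instead of as a span of \<open>B\<close>: closure under
  sums and scalars is then immediate, and each further factor from \<open>lin B\<close> raises the
  degree by one.\<close>

definition lin :: "'r set \<Rightarrow> 'r set" where
  "lin B = {a. \<forall>d w x. x \<in> fspan ((*) w ` products B d) \<longrightarrow> a * x \<in> fspan ((*) w ` products B (Suc d))}"

lemma lin_0: "0 \<in> lin B"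
  by (simp add: lin_def zero)

lemma lin_base:
  assumes "t \<in> B"
  shows "t \<in> lin B"
  unfolding lin_def
proof (intro CollectI allI impI)
  fix d w x
  assume "x \<in> fspan ((*) w ` products B d)"
  then have "t * x \<in> fspan ((*) t ` (*) w ` products B d)"
    by (rule fspan_mult)
  moreover have "(*) t ` (*) w ` products B d \<subseteq> (*) w ` products B (Suc d)"
  proof clarify
    fix u
    assume "u \<in> products B d"
    then have "u * t \<in> products B (Suc d)"
      using imageI[of "(u, t)" "products B d \<times> B" "\<lambda>(u, t). u * t"] assms by simp
    then have "w * (u * t) \<in> (*) w ` products B (Suc d)"
      by (rule imageI)
    then show "t * (w * u) \<in> (*) w ` products B (Suc d)"
      by (simp only: mult_ac)
  qed
  ultimately show "t * x \<in> fspan ((*) w ` products B (Suc d))"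
    by (rule fspan_mono)
qed

lemma lin_add: "a \<in> lin B \<Longrightarrow> b \<in> lin B \<Longrightarrow> a + b \<in> lin B"
  unfolding lin_def by (simp add: distrib_right add)

lemma lin_scale: "s \<in> S \<Longrightarrow> a \<in> lin B \<Longrightarrow> s * a \<in> lin B"
  unfolding lin_def by (simp add: mult.assoc scale)

lemma lin_sum: "(\<And>i. i \<in> I \<Longrightarrow> f i \<in> lin B) \<Longrightarrow> sum f I \<in> lin B"
  by (induction I rule: infinite_finite_induct) (auto intro: lin_0 lin_add)

lemma lin_power:
  assumes "a \<in> lin B" "x \<in> fspan ((*) w ` products B d)"
  shows "a ^ n * x \<in> fspan ((*) w ` products B (d + n))"
proof (induction n)
  case (Suc n)
  then show ?case
    using assms(1) by (simp add: lin_def mult.assoc)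
qed (use assms in auto)

text \<open>In the span, \<open>1 / a\<close> can be traded for \<open>a ^ (p - 1)\<close> because \<open>a ^ p\<close> is a scalar.\<close>

lemma fspan_mult_raise:
  assumes "a \<in> lin B" "a ^ p \<in> S" "a \<noteq> 0" "p > 0" "x \<in> fspan ((*) w ` products B d)"
  shows "x \<in> fspan ((*) (a * w) ` products B (d + (p - 1)))"
proof (rule cancel)
  have "a * x \<in> fspan ((*) a ` (*) w ` products B d)"
    by (rule fspan_mult[OF assms(5)])
  also have "(*) a ` (*) w ` products B d = (*) (a * w) ` products B d"
    by (simp add: image_image mult.assoc)
  finally have "a ^ (p - 1) * (a * x) \<in> fspan ((*) (a * w) ` products B (d + (p - 1)))"
    by (rule lin_power[OF assms(1)])
  also have "a ^ (p - 1) * (a * x) = a ^ p * x"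
    using assms(4) by (metis mult.assoc power_minus_mult)
  finally show "a ^ p * x \<in> fspan ((*) (a * w) ` products B (d + (p - 1)))" .
qed (use assms in auto)

lemma fspan_mult_same:
  assumes "x \<in> fspan ((*) w ` products B d)"
  shows "a * x \<in> fspan ((*) (a * w) ` products B d)"
  using fspan_mult[OF assms, of a] by (simp add: image_image mult.assoc)

lemma fspan_products_mono:
  assumes "x \<in> fspan ((*) w ` products B d)" "1 \<in> B" "d \<le> e"
  shows "x \<in> fspan ((*) w ` products B e)"
  using assms products_mono[of B d e] by (intro fspan_mono[OF assms(1)]) auto

text \<open>When all \<open>a j\<close> are nonzero, the coefficients of 1, z, z' and z z' are
  \<open>W J\<close> times scalar combinations of products of zero, one, one and two inverses
  \<open>1 / a j\<close>. Each inverse costs degree \<open>p - 1\<close>, whence the four degrees. A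
  factor with \<open>a j = 0\<close> has no inverse and enters \<open>W\<close> as 1.\<close>

lemma coeff2_prod_in_fspan:
  fixes x :: "'j \<Rightarrow> 'r poly poly" and a :: "'j \<Rightarrow> 'r"
  assumes "finite J" "1 \<in> B" "p > 0"
    and a: "\<And>j. j \<in> J \<Longrightarrow> coeff2 (x j) 0 0 = a j" "\<And>j. j \<in> J \<Longrightarrow> a j \<in> lin B" "\<And>j. j \<in> J \<Longrightarrow> a j ^ p \<in> S"
    and bc: "\<And>j. j \<in> J \<Longrightarrow> coeff2 (x j) 1 0 \<in> S" "\<And>j. j \<in> J \<Longrightarrow> coeff2 (x j) 0 1 \<in> S"
      "\<And>j. j \<in> J \<Longrightarrow> coeff2 (x j) 1 1 = 0"
  defines "W \<equiv> \<lambda>J. \<Prod>j\<in>J. if a j = 0 then 1 else a j"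
  shows "coeff2 (prod x J) 0 0 \<in> fspan ((*) (W J) ` products B 0) \<and>
    coeff2 (prod x J) 1 0 \<in> fspan ((*) (W J) ` products B (p - 1)) \<and>
    coeff2 (prod x J) 0 1 \<in> fspan ((*) (W J) ` products B (p - 1)) \<and>
    coeff2 (prod x J) 1 1 \<in> fspan ((*) (W J) ` products B (2 * (p - 1)))"
  using \<open>finite J\<close> a bc
proof (induction J rule: finite_induct)
  case empty
  then show ?case
    by (simp add: W_def base zero)
next
  case (insert j J)
  define P where "P = prod x J"
  define \<alpha> \<beta> \<gamma> where "\<alpha> = a j" and "\<beta> = coeff2 (x j) 1 0" and "\<gamma> = coeff2 (x j) 0 1"
  define F where "F w d = fspan ((*) w ` products B d)" for w d
  have IH: "coeff2 P 0 0 \<in> F (W J) 0" "coeff2 P 1 0 \<in> F (W J) (p - 1)"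
    "coeff2 P 0 1 \<in> F (W J) (p - 1)" "coeff2 P 1 1 \<in> F (W J) (2 * (p - 1))"
    unfolding F_def P_def using insert.IH[OF insert.prems] by simp_all
  have \<alpha>: "\<alpha> \<in> lin B" "\<alpha> ^ p \<in> S" and S: "\<beta> \<in> S" "\<gamma> \<in> S"
    using insert.prems(2-5) by (simp_all add: \<alpha>_def \<beta>_def \<gamma>_def)
  have add: "y + z \<in> F w d" if "y \<in> F w d" "z \<in> F w d" for y z w d
    using that by (simp add: F_def fspan.add)
  have scale: "s * z \<in> F w d" if "s \<in> S" "z \<in> F w d" for s z w d
    using that by (simp add: F_def fspan.scale)
  have eqs: "prod x (insert j J) = x j * P" "coeff2 (x j) 0 0 = \<alpha>" "coeff2 (x j) 1 1 = 0"
    using insert.hyps insert.prems(1,6) by (simp_all add: P_def \<alpha>_def)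
  \<comment> \<open>The product rule; the new factor \<open>x j\<close> has no term in z z'.\<close>
  have C: "coeff2 (prod x (insert j J)) 0 0 = \<alpha> * coeff2 P 0 0"
    "coeff2 (prod x (insert j J)) 1 0 = \<alpha> * coeff2 P 1 0 + \<beta> * coeff2 P 0 0"
    "coeff2 (prod x (insert j J)) 0 1 = \<alpha> * coeff2 P 0 1 + \<gamma> * coeff2 P 0 0"
    "coeff2 (prod x (insert j J)) 1 1 = \<alpha> * coeff2 P 1 1 + \<gamma> * coeff2 P 1 0 + \<beta> * coeff2 P 0 1"
    unfolding eqs(1) coeff2_mult eqs(2,3) \<beta>_def \<gamma>_def by simp_all
  have main: "coeff2 (prod x (insert j J)) 0 0 \<in> F (W (insert j J)) 0 \<and>
    coeff2 (prod x (insert j J)) 1 0 \<in> F (W (insert j J)) (p - 1) \<and>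
    coeff2 (prod x (insert j J)) 0 1 \<in> F (W (insert j J)) (p - 1) \<and>
    coeff2 (prod x (insert j J)) 1 1 \<in> F (W (insert j J)) (2 * (p - 1))"
  proof (cases "\<alpha> = 0")
    \<comment> \<open>Only the terms with \<beta> or \<gamma> remain. \<open>W\<close> is unchanged,
      and the degree bounds merely get weaker.\<close>
    case True
    have mono: "z \<in> F w e" if "z \<in> F w d" "d \<le> e" for z w d e
      using that fspan_products_mono \<open>1 \<in> B\<close> by (simp add: F_def)
    have "W (insert j J) = W J"
      using insert.hyps True by (simp add: W_def \<alpha>_def)
    moreover have "0 \<in> F (W J) 0"
      by (simp add: F_def zero)
    moreover have "coeff2 P 0 0 \<in> F (W J) (p - 1)"
      using mono[OF IH(1)] by simp
    moreover have "coeff2 P 1 0 \<in> F (W J) (2 * (p - 1))" "coeff2 P 0 1 \<in> F (W J) (2 * (p - 1))"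
      using mono[OF IH(2)] mono[OF IH(3)] by simp_all
    ultimately show ?thesis
      unfolding C using True S by (simp add: add scale)
  next
    \<comment> \<open>Terms multiplied by \<alpha> receive the new factor of \<open>W\<close>
      directly. The others still carry \<open>W J\<close> and are raised by degree
      \<open>p - 1\<close> to match \<open>\<alpha> * W J\<close>.\<close>
    case False
    have W: "W (insert j J) = \<alpha> * W J"
      using insert.hyps False by (simp add: W_def \<alpha>_def)
    have same: "\<alpha> * z \<in> F (\<alpha> * w) d" if "z \<in> F w d" for z w d
      using that fspan_mult_same by (simp add: F_def)
    have raise: "z \<in> F (\<alpha> * w) (d + (p - 1))" if "z \<in> F w d" for z w d
      using that \<alpha> False \<open>p > 0\<close> fspan_mult_raise by (simp add: F_def)
    have "coeff2 P 0 0 \<in> F (\<alpha> * W J) (p - 1)"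
      using raise[OF IH(1)] by simp
    moreover have "coeff2 P 1 0 \<in> F (\<alpha> * W J) (2 * (p - 1))" "coeff2 P 0 1 \<in> F (\<alpha> * W J) (2 * (p - 1))"
      using raise[OF IH(2)] raise[OF IH(3)] by (simp_all add: mult_2)
    ultimately show ?thesis
      unfolding C W using IH S by (simp add: add scale same)
  qed
  then show ?case
    by (simp add: F_def)
qed

end

section \<open>Extraction of the coefficient of z z' from sums of products\<close>

definition jet_const :: "'b::comm_ring_1 \<Rightarrow> 'b mpoly poly poly" where
  "jet_const a = [:[:const_mpoly a:]:]"

definition yvar :: "nat \<Rightarrow> 'b::comm_ring_1 mpoly" where
  "yvar a = Poly_Mapping.single (Poly_Mapping.single a 1) 1"

definition jet_var :: "nat set \<Rightarrow> nat \<Rightarrow> nat \<Rightarrow> nat \<Rightarrow> 'b::comm_ring_1 mpoly poly poly" where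
  "jet_var Y z z' a =
     (if a = z then [:0, 1:] else if a = z' then [:[:0, 1:]:] else if a \<in> Y then [:[:yvar a:]:] else 0)"

lemma mpoly_subst_jet_const: "mpoly_subst jet_const"
  by standard (auto simp: jet_const_def const_mpoly_add const_mpoly_mult one_pCons)

text \<open>
  \<open>coeff2 (jet Y z z' q) 1 1\<close> is the coefficient of \<open>z * z'\<close> in \<open>q\<close>, a polynomial in the variables
  from \<open>Y\<close>; all variables other than these are set to \<open>0\<close>.
\<close>

definition jet :: "nat set \<Rightarrow> nat \<Rightarrow> nat \<Rightarrow> 'b::comm_ring_1 mpoly \<Rightarrow> 'b mpoly poly poly" where
  "jet Y z z' = mpoly_subst.subst jet_const (jet_var Y z z')"

lemmas jet_hom =
  mpoly_subst.subst_add[OF mpoly_subst_jet_const, where g = "jet_var Y z z'" for Y z z', folded jet_def]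
  mpoly_subst.subst_sum[OF mpoly_subst_jet_const, where g = "jet_var Y z z'" for Y z z', folded jet_def]
  mpoly_subst.subst_mult[OF mpoly_subst_jet_const, where g = "jet_var Y z z'" for Y z z', folded jet_def]
  mpoly_subst.subst_prod[OF mpoly_subst_jet_const, where g = "jet_var Y z z'" for Y z z', folded jet_def]
  mpoly_subst.subst_const[OF mpoly_subst_jet_const, where g = "jet_var Y z z'" for Y z z', folded jet_def]
  mpoly_subst.subst_single[OF mpoly_subst_jet_const, where g = "jet_var Y z z'" for Y z z', folded jet_def]

lemma coeff2_jet_const_mult: "coeff2 (jet_const a * x) r s = const_mpoly a * coeff2 x r s"
  by (simp add: jet_const_def)

lemma coeff2_jet:
  "coeff2 (jet Y z z' q) r s = (\<Sum>m\<in>Poly_Mapping.keys q.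
     const_mpoly (Poly_Mapping.lookup q m) * coeff2 (monom_value (jet_var Y z z') m) r s)"
  by (simp add: jet_def mpoly_subst.subst_def[OF mpoly_subst_jet_const] coeff_sum coeff2_jet_const_mult)

text \<open>The part of \<open>q\<close> left when all variables outside \<open>Y\<close> are set to
  0; the constant term is kept, since its monomial has no keys. It is the \<open>a\<close> in an
  affine factor a + b z + c z'.\<close>

definition affine_part :: "nat set \<Rightarrow> 'b::comm_ring_1 mpoly \<Rightarrow> 'b mpoly" where
  "affine_part Y q = (\<Sum>m\<in>Poly_Mapping.keys q.
     const_mpoly (Poly_Mapping.lookup q m) * (if Poly_Mapping.keys m \<subseteq> Y then Poly_Mapping.single m 1 else 0))"

text \<open>A monomial of degree at most 1 is 1 or a single variable: z and z' therefore carry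
  constants, which are scalars, and z z' cannot occur.\<close>

lemma coeff2_jet_affine:
  fixes q :: "'b::idom mpoly"
  assumes q: "q \<in> affine_mpolys n" and z: "z \<notin> Y" "z' \<notin> Y" "z \<noteq> z'"
  shows "coeff2 (jet Y z z' q) 0 0 = affine_part Y q"
    "coeff2 (jet Y z z' q) 1 0 \<in> pth_exponents p"
    "coeff2 (jet Y z z' q) 0 1 \<in> pth_exponents p"
    "coeff2 (jet Y z z' q) 1 1 = 0"
proof -
  interpret domain_subring "pth_exponents p :: 'b mpoly set"
    by (rule domain_subring_pth_exponents)
  have *: "coeff2 (monom_value (jet_var Y z z') m) 0 0
        = (if Poly_Mapping.keys m \<subseteq> Y then Poly_Mapping.single m 1 else 0 :: 'b mpoly)"
      "coeff2 (monom_value (jet_var Y z z') m) 1 0 \<in> {0, 1 :: 'b mpoly}"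
      "coeff2 (monom_value (jet_var Y z z') m) 0 1 \<in> {0, 1 :: 'b mpoly}"
      "coeff2 (monom_value (jet_var Y z z') m) 1 1 = (0 :: 'b mpoly)"
    if m: "m \<in> Poly_Mapping.keys q" for m
  proof -
    have "monom_degree m \<le> 1"
      using q m by (auto simp: affine_mpolys_def)
    then consider "m = 0" | a where "m = Poly_Mapping.single a 1"
      using monom_degree_le_1 by blast
    then have "coeff2 (monom_value (jet_var Y z z') m) 0 0
        = (if Poly_Mapping.keys m \<subseteq> Y then Poly_Mapping.single m 1 else 0 :: 'b mpoly) \<and>
      coeff2 (monom_value (jet_var Y z z') m) 1 0 \<in> {0, 1 :: 'b mpoly} \<and>
      coeff2 (monom_value (jet_var Y z z') m) 0 1 \<in> {0, 1 :: 'b mpoly} \<and>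
      coeff2 (monom_value (jet_var Y z z') m) 1 1 = (0 :: 'b mpoly)"
    proof cases
      case 1
      then show ?thesis
        by (simp add: one_pCons)
    next
      case 2
      then show ?thesis
        using z by (auto simp: jet_var_def yvar_def one_pCons)
    qed
    then show "coeff2 (monom_value (jet_var Y z z') m) 0 0
        = (if Poly_Mapping.keys m \<subseteq> Y then Poly_Mapping.single m 1 else 0 :: 'b mpoly)"
      "coeff2 (monom_value (jet_var Y z z') m) 1 0 \<in> {0, 1 :: 'b mpoly}"
      "coeff2 (monom_value (jet_var Y z z') m) 0 1 \<in> {0, 1 :: 'b mpoly}"
      "coeff2 (monom_value (jet_var Y z z') m) 1 1 = (0 :: 'b mpoly)"
      by blast+
  qed
  show "coeff2 (jet Y z z' q) 0 0 = affine_part Y q"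
    unfolding coeff2_jet affine_part_def by (intro sum.cong refl) (simp only: *(1))
  have mem: "t \<in> pth_exponents p" if "t \<in> {0, 1 :: 'b mpoly}" for t
    using that by auto
  show "coeff2 (jet Y z z' q) 1 0 \<in> pth_exponents p"
    unfolding coeff2_jet by (intro sum_mem mult_mem const_in_pth_exponents mem *(2))
  show "coeff2 (jet Y z z' q) 0 1 \<in> pth_exponents p"
    unfolding coeff2_jet by (intro sum_mem mult_mem const_in_pth_exponents mem *(3))
  show "coeff2 (jet Y z z' q) 1 1 = 0"
    unfolding coeff2_jet by (intro sum.neutral ballI) (simp only: *(4) mult_zero_right)
qed

text \<open>These are the two properties that allow division by an affine part inside a span: it is
  a scalar combination of 1 and the variables in \<open>Y\<close>, and by Frobenius its p-th power
  is a scalar.\<close>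

lemma affine_part_props:
  fixes q :: "'b::idom mpoly"
  assumes q: "q \<in> affine_mpolys n" and p: "prime p" "CHAR('b) = p"
  shows "affine_part Y q \<in> domain_subring.lin (pth_exponents p) (insert 1 (yvar ` Y))"
    and "affine_part Y q ^ p \<in> pth_exponents p"
proof -
  interpret domain_subring "pth_exponents p :: 'b mpoly set"
    by (rule domain_subring_pth_exponents)
  let ?t = "\<lambda>m. if Poly_Mapping.keys m \<subseteq> Y then Poly_Mapping.single m 1 else 0 :: 'b mpoly"
  have *: "?t m = 0 \<or> ?t m \<in> insert 1 (yvar ` Y)" if m: "m \<in> Poly_Mapping.keys q" for m
  proof -
    have "monom_degree m \<le> 1"
      using q m by (auto simp: affine_mpolys_def)
    then consider "m = 0" | a where "m = Poly_Mapping.single a 1"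
      using monom_degree_le_1 by blast
    then show ?thesis
      by cases (auto simp: yvar_def)
  qed
  have "?t m \<in> lin (insert 1 (yvar ` Y))" if "m \<in> Poly_Mapping.keys q" for m
    using *[OF that] lin_0 lin_base by metis
  then show "affine_part Y q \<in> lin (insert 1 (yvar ` Y))"
    unfolding affine_part_def by (intro lin_sum lin_scale const_in_pth_exponents)
  have pw: "?t m ^ p \<in> pth_exponents p" if "m \<in> Poly_Mapping.keys q" for m
  proof -
    have "Poly_Mapping.single (Poly_Mapping.single a 1) 1 ^ k = (Poly_Mapping.single (Poly_Mapping.single a k) 1 :: 'b mpoly)" for a k
    proof (induction k)
      case (Suc k)
      then show ?case
        by (simp add: mult_single flip: single_add)
    qed simp
    then have "yvar a ^ p \<in> (pth_exponents p :: 'b mpoly set)" for a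
      by (auto simp: yvar_def pth_exponents_def lookup_single when_def)
    then have "t ^ p \<in> pth_exponents p" if "t = 0 \<or> t \<in> insert 1 (yvar ` Y)" for t :: "'b mpoly"
      using that prime_gt_0_nat[OF p(1)] by (auto simp: zero_power)
    then show ?thesis
      using *[OF that] by blast
  qed
  \<comment> \<open>Frobenius turns the p-th power of the sum into a sum of p-th powers, and each
    variable then has exponent \<open>p\<close>.\<close>
  have "affine_part Y q ^ p = (\<Sum>m\<in>Poly_Mapping.keys q. (const_mpoly (Poly_Mapping.lookup q m) * ?t m) ^ p)"
    unfolding affine_part_def using p by (intro freshmans_dream_sum) (simp_all add: CHAR_poly_mapping)
  also have "\<dots> \<in> pth_exponents p"
    unfolding power_mult_distrib by (intro sum_mem mult_mem power_mem const_in_pth_exponents pw)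
  finally show "affine_part Y q ^ p \<in> pth_exponents p" .
qed

text \<open>The same \<open>U\<close> serves all pairs z, z', because \<open>W\<close> and the
  degree bound depend only on the affine parts in \<open>Y\<close>. Each of the \<open>k\<close>
  products contributes one multiple of the monomials of degree at most
  \<open>2 * (p - 1)\<close>.\<close>

lemma depth3_jets_in_fspan:
  fixes l :: "nat \<Rightarrow> nat \<Rightarrow> 'b::idom mpoly"
  assumes p: "prime p" "CHAR('b) = p" and Y: "finite Y"
    and l: "\<forall>i\<in>{1..k}. \<forall>j\<in>{1..m i}. l i j \<in> affine_mpolys n"
  shows "\<exists>U. finite U \<and> card U \<le> k * (card Y + 1) ^ (2 * (p - 1)) \<and>
    (\<forall>z z'. z \<notin> Y \<longrightarrow> z' \<notin> Y \<longrightarrow> z \<noteq> z' \<longrightarrow>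
      coeff2 (jet Y z z' (\<Sum>i=1..k. const_mpoly (c i) * (\<Prod>j=1..m i. l i j))) 1 1
        \<in> domain_subring.fspan (pth_exponents p) U)"
proof -
  interpret domain_subring "pth_exponents p :: 'b mpoly set"
    by (rule domain_subring_pth_exponents)
  let ?B = "insert 1 (yvar ` Y) :: 'b mpoly set"
  let ?d = "2 * (p - 1)"
  define W where "W i = (\<Prod>j=1..m i. if affine_part Y (l i j) = 0 then 1 else affine_part Y (l i j))" for i
  define G where "G i = (*) (W i) ` products ?B ?d" for i
  define U where "U = (\<Union>i\<in>{1..k}. G i)"
  have fin: "finite ?B" using Y by simp
  have "card ?B \<le> card Y + 1"
    using card_insert_le_m1 card_image_le[OF Y, of "yvar :: nat \<Rightarrow> 'b mpoly"]
    by (metis Suc_eq_plus1 card_insert_if fin finite_insert le_SucI Suc_le_mono)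
  then have "card (G i) \<le> (card Y + 1) ^ ?d" for i
    unfolding G_def using card_image_le[OF finite_products[OF fin], of "(*) (W i)" ?d] card_products[OF fin, of ?d]
    by (meson le_trans power_mono zero_le)
  then have "card U \<le> k * (card Y + 1) ^ ?d"
    unfolding U_def using card_UN_le[of "{1..k}" G] sum_bounded_above[of "{1..k}" "\<lambda>i. card (G i)"]
    by (metis (no_types, lifting) card_atLeastAtMost diff_Suc_1 finite_atLeastAtMost le_trans of_nat_id)
  moreover have "finite U"
    by (auto simp: U_def G_def finite_products[OF fin] simp del: products.simps)
  moreover have "coeff2 (jet Y z z' (\<Sum>i=1..k. const_mpoly (c i) * (\<Prod>j=1..m i. l i j))) 1 1 \<in> fspan U"
    if z: "z \<notin> Y" "z' \<notin> Y" "z \<noteq> z'" for z z'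
  proof -
    have "coeff2 (\<Prod>j=1..m i. jet Y z z' (l i j)) 1 1 \<in> fspan (G i)" if i: "i \<in> {1..k}" for i
    proof -
      have "p > 0" using p(1) by (rule prime_gt_0_nat)
      then show ?thesis
        unfolding G_def W_def
        using coeff2_prod_in_fspan[of "{1..m i}" ?B p "\<lambda>j. jet Y z z' (l i j)" "\<lambda>j. affine_part Y (l i j)"]
          coeff2_jet_affine[OF l[rule_format, OF i] z] affine_part_props[OF l[rule_format, OF i] p] by blast
    qed
    then have "coeff2 (\<Prod>j=1..m i. jet Y z z' (l i j)) 1 1 \<in> fspan U" if "i \<in> {1..k}" for i
      using that fspan_mono[of _ "G i" U] unfolding U_def by blast
    then have "(\<Sum>i=1..k. const_mpoly (c i) * coeff2 (\<Prod>j=1..m i. jet Y z z' (l i j)) 1 1) \<in> fspan U"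
      by (intro fspan_sum scale const_in_pth_exponents)
    then show ?thesis
      by (simp only: jet_hom coeff_sum coeff2_jet_const_mult)
  qed
  ultimately show ?thesis by blast
qed

section \<open>Integrality of coefficients\<close>

definition coeffs_in :: "'b::zero set \<Rightarrow> 'b mpoly set" where
  "coeffs_in R = {q. \<forall>m. Poly_Mapping.lookup q m \<in> R}"

lemma (in domain_subring) domain_subring_coeffs_in: "domain_subring (coeffs_in S)"
proof
  fix a b :: "'r mpoly"
  assume ab: "a \<in> coeffs_in S" "b \<in> coeffs_in S"
  then show "a + b \<in> coeffs_in S"
    by (simp add: coeffs_in_def lookup_add add_mem)
  show "- a \<in> coeffs_in S"
    using ab by (simp add: coeffs_in_def uminus_mem)
  let ?l = Poly_Mapping.lookup and ?s = Poly_Mapping.single and ?k = Poly_Mapping.keys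
  have "a * b = (\<Sum>m\<in>?k a. ?s m (?l a m)) * (\<Sum>m\<in>?k b. ?s m (?l b m))"
    by (simp add: sum_single_lookup)
  also have "\<dots> = (\<Sum>m\<in>?k a. \<Sum>m'\<in>?k b. ?s (m + m') (?l a m * ?l b m'))"
    by (simp only: sum_product mult_single)
  finally show "a * b \<in> coeffs_in S"
    using ab by (auto simp: coeffs_in_def lookup_sum lookup_single when_def intro!: sum_mem mult_mem)
qed (auto simp: coeffs_in_def lookup_one when_def)

lemma (in domain_subring) domain_subring_poly: "domain_subring {x :: 'r poly. \<forall>r. coeff x r \<in> S}"
  by standard (auto simp: coeff_mult intro!: add_mem uminus_mem sum_mem mult_mem)

text \<open>The substitution introduces only the coefficients 0 and 1. It will show that the error
  term \<open>Q\<close> keeps coefficients polynomial in eps.\<close>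

lemma coeff2_jet_in_coeffs_in:
  fixes q :: "'b::idom mpoly"
  assumes R: "domain_subring R" and q: "q \<in> coeffs_in R"
  shows "coeff2 (jet Y z z' q) r s \<in> coeffs_in R"
proof -
  \<comment> \<open>Four levels of subrings: coefficients, polynomials in the variables, and two
    nested layers for z' and z.\<close>
  interpret R: domain_subring R by (rule R)
  interpret C: domain_subring "coeffs_in R" by (rule R.domain_subring_coeffs_in)
  interpret P: domain_subring "{x. \<forall>r. coeff x r \<in> coeffs_in R}" by (rule C.domain_subring_poly)
  interpret PP: domain_subring "{x. \<forall>r. coeff x r \<in> {x. \<forall>r. coeff x r \<in> coeffs_in R}}"
    by (rule P.domain_subring_poly)
  have "yvar a \<in> coeffs_in R" for a
    by (auto simp: yvar_def coeffs_in_def lookup_single when_def)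
  then have "jet_var Y z z' a \<in> {x. \<forall>r. coeff x r \<in> {x. \<forall>r. coeff x r \<in> coeffs_in R}}" for a
    by (auto simp: jet_var_def coeff_pCons split: nat.splits)
  then have "monom_value (jet_var Y z z') m \<in> {x. \<forall>r. coeff x r \<in> {x. \<forall>r. coeff x r \<in> coeffs_in R}}" for m
    unfolding monom_value_def by (intro PP.prod_mem PP.power_mem)
  then have "coeff2 (monom_value (jet_var Y z z') m) r s \<in> coeffs_in R" for m
    by simp
  moreover have "const_mpoly (Poly_Mapping.lookup q m) \<in> coeffs_in R" for m
    using q by (simp add: const_mpoly_def coeffs_in_def lookup_single when_def)
  ultimately show ?thesis
    unfolding coeff2_jet by (intro C.sum_mem C.mult_mem)
qed

section \<open>Independence of small monomials over p-th powers, up to a perturbation\<close>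

lemma lookup_mult_monom:
  "Poly_Mapping.lookup (q * Poly_Mapping.single t 1) n
     = (\<Sum>m\<in>Poly_Mapping.keys q. if m + t = n then Poly_Mapping.lookup q m else 0)"
  for q :: "'b::comm_ring_1 mpoly"
proof -
  have "q * Poly_Mapping.single t 1 = (\<Sum>m\<in>Poly_Mapping.keys q. Poly_Mapping.single (m + t) (Poly_Mapping.lookup q m))"
    by (subst sum_single_lookup[of q, symmetric], simp only: sum_distrib_right) (simp add: mult_single)
  then show ?thesis
    by (simp add: lookup_sum lookup_single when_def)
qed

text \<open>
  Exponents in \<open>T i\<close> are smaller than \<open>p\<close>, so a term of \<open>g i * T i\<close> determines \<open>i\<close>. Hence a relation
  modulo \<open>e\<close> forces all coefficients of all \<open>g i\<close> to be divisible by \<open>e\<close>.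
\<close>

lemma relation_coeffs_divisible:
  fixes g Q :: "'i \<Rightarrow> 'b::field mpoly"
  assumes I: "finite I" and R: "domain_subring R"
    and T: "inj_on T I" "\<And>i a. i \<in> I \<Longrightarrow> Poly_Mapping.lookup (T i) a < p"
    and Q: "\<And>i. i \<in> I \<Longrightarrow> Q i \<in> coeffs_in R"
    and g: "\<And>i. i \<in> I \<Longrightarrow> g i \<in> pth_exponents p" "\<And>i. i \<in> I \<Longrightarrow> g i \<in> coeffs_in R"
    and rel: "(\<Sum>i\<in>I. g i * (Poly_Mapping.single (T i) 1 + const_mpoly e * Q i)) = 0"
    and i: "i \<in> I"
  shows "\<exists>y\<in>R. Poly_Mapping.lookup (g i) m = e * y"
proof (cases "m \<in> Poly_Mapping.keys (g i)")
  case False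
  then show ?thesis
    using domain_subring.zero_mem[OF R] by (intro bexI[of _ 0]) (auto simp: in_keys_iff)
next
  case True
  interpret R: domain_subring R by (rule R)
  interpret C: domain_subring "coeffs_in R" by (rule R.domain_subring_coeffs_in)
  let ?l = Poly_Mapping.lookup
  \<comment> \<open>Modulo \<open>p\<close> the exponents of \<open>m\<close> and \<open>m'\<close>
    vanish, so those of \<open>T j\<close> and \<open>T i\<close> agree; being below
    \<open>p\<close>, they are equal.\<close>
  have eq: "j = i \<and> m' = m" if j: "j \<in> I" "m' \<in> Poly_Mapping.keys (g j)" "m' + T j = m + T i" for j m'
  proof -
    have "?l (T j) a = ?l (T i) a" for a
    proof -
      have "?l m' a + ?l (T j) a = ?l m a + ?l (T i) a"
        using j(3) by (metis lookup_add)
      moreover have "?l m' a mod p = 0" "?l m a mod p = 0"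
        using g(1)[OF j(1)] g(1)[OF i] j(2) True by (auto simp: pth_exponents_def)
      ultimately have "?l (T j) a mod p = ?l (T i) a mod p"
        by (metis add.left_neutral mod_add_left_eq)
      then show ?thesis
        using T(2)[OF j(1)] T(2)[OF i] by simp
    qed
    then have "T j = T i"
      by (intro poly_mapping_eqI) simp
    then show ?thesis
      using T(1) i j by (auto dest: inj_onD)
  qed
  have "?l (g j * Poly_Mapping.single (T j) 1) (m + T i) = (if j = i then ?l (g i) m else 0)" if j: "j \<in> I" for j
  proof -
    have "?l (g j * Poly_Mapping.single (T j) 1) (m + T i)
        = (\<Sum>m'\<in>Poly_Mapping.keys (g j). if m' = m then if j = i then ?l (g i) m else 0 else 0)"
      unfolding lookup_mult_monom using eq[OF j] by (intro sum.cong refl) auto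
    then show ?thesis
      using True by simp
  qed
  then have "(\<Sum>j\<in>I. ?l (g j * Poly_Mapping.single (T j) 1) (m + T i)) = ?l (g i) m"
    using I i by simp
  moreover define q where "q = (\<Sum>j\<in>I. g j * Q j)"
  have "(\<Sum>j\<in>I. g j * Poly_Mapping.single (T j) 1) + const_mpoly e * q = 0"
    using rel by (simp add: q_def distrib_left sum.distrib sum_distrib_left mult.left_commute)
  \<comment> \<open>Comparing coefficients at \<open>m + T i\<close> isolates \<open>g i\<close> at
    \<open>m\<close>; everything else is a multiple of \<open>e\<close>.\<close>
  from arg_cong[OF this, of "\<lambda>x. ?l x (m + T i)"]
  have "(\<Sum>j\<in>I. ?l (g j * Poly_Mapping.single (T j) 1) (m + T i)) + e * ?l q (m + T i) = 0"
    by (simp only: lookup_add lookup_const_mult lookup_sum lookup_zero)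
  ultimately have "?l (g i) m + e * ?l q (m + T i) = 0"
    by simp
  then have "?l (g i) m = e * - ?l q (m + T i)"
    by (simp add: eq_neg_iff_add_eq_0)
  moreover have "q \<in> coeffs_in R"
    unfolding q_def using g Q by (intro C.sum_mem C.mult_mem)
  then have "- ?l q (m + T i) \<in> R"
    by (intro R.uminus_mem) (simp add: coeffs_in_def)
  ultimately show ?thesis by blast
qed

text \<open>Descent: after division of the relation by \<open>e\<close> the coefficients are still
  in \<open>R\<close>, so the divisibility can be applied again.\<close>

lemma relation_coeffs_divisible_power:
  fixes g Q :: "'i \<Rightarrow> 'b::field mpoly"
  assumes I: "finite I" and R: "domain_subring R" and e: "e \<noteq> 0"
    and T: "inj_on T I" "\<And>i a. i \<in> I \<Longrightarrow> Poly_Mapping.lookup (T i) a < p"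
    and Q: "\<And>i. i \<in> I \<Longrightarrow> Q i \<in> coeffs_in R"
    and g: "\<And>i. i \<in> I \<Longrightarrow> g i \<in> pth_exponents p" "\<And>i. i \<in> I \<Longrightarrow> g i \<in> coeffs_in R"
    and rel: "(\<Sum>i\<in>I. g i * (Poly_Mapping.single (T i) 1 + const_mpoly e * Q i)) = 0"
    and i: "i \<in> I"
  shows "\<exists>y\<in>R. Poly_Mapping.lookup (g i) m = e ^ n * y"
  using g rel
proof (induction n arbitrary: g)
  case 0
  then show ?case
    using i by (auto simp: coeffs_in_def)
next
  case (Suc n)
  define h where "h i = const_mpoly (inverse e) * g i" for i
  have "h j \<in> pth_exponents p" if "j \<in> I" for j
    unfolding h_def using Suc.prems(1)[OF that] const_in_pth_exponents
      domain_subring.mult_mem[OF domain_subring_pth_exponents] by blast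
  moreover have "h j \<in> coeffs_in R" if j: "j \<in> I" for j
    unfolding coeffs_in_def
  proof (intro CollectI allI)
    fix m
    obtain y where "y \<in> R" "Poly_Mapping.lookup (g j) m = e * y"
      using relation_coeffs_divisible[OF I R T Q Suc.prems j] by blast
    then show "Poly_Mapping.lookup (h j) m \<in> R"
      using e by (simp add: h_def lookup_const_mult flip: mult.assoc)
  qed
  moreover have "(\<Sum>i\<in>I. h i * (Poly_Mapping.single (T i) 1 + const_mpoly e * Q i)) = 0"
    unfolding h_def mult.assoc sum_distrib_left[symmetric] Suc.prems(3) by simp
  ultimately obtain y where y: "y \<in> R" "Poly_Mapping.lookup (h i) m = e ^ n * y"
    using Suc.IH by blast
  have "Poly_Mapping.lookup (g i) m = e * Poly_Mapping.lookup (h i) m"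
    using e by (simp add: h_def lookup_const_mult)
  with y show ?case
    by (intro bexI[of _ y]) simp_all
qed

section \<open>Rational functions in \<open>\<epsilon>\<close>\<close>

lemma domain_subring_range_to_fract: "domain_subring (range (to_fract :: 'a::idom \<Rightarrow> 'a fract))"
proof
  show "0 \<in> range (to_fract :: 'a \<Rightarrow> 'a fract)" "1 \<in> range (to_fract :: 'a \<Rightarrow> 'a fract)"
    by (metis rangeI to_fract_0, metis rangeI to_fract_1)
qed (auto simp flip: to_fract_add to_fract_mult to_fract_uminus)

lemma exists_common_denominator:
  fixes A :: "'a::idom fract set"
  assumes "finite A"
  shows "\<exists>d. d \<noteq> 0 \<and> (\<forall>a\<in>A. to_fract d * a \<in> range to_fract)"
  using assms
proof (induction A rule: finite_induct)
  case empty
  show ?case by (intro exI[of _ 1]) simp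
next
  case (insert a A)
  then obtain d where d: "d \<noteq> 0" "\<And>a. a \<in> A \<Longrightarrow> to_fract d * a \<in> range to_fract"
    by blast
  obtain x y where a: "a = Fract x y" "y \<noteq> 0"
    by (cases a) auto
  have "to_fract (d * y) * b \<in> range to_fract" if "b \<in> insert a A" for b
  proof (cases "b = a")
    case True
    have "to_fract (d * y) * b = to_fract (d * x)"
      using a True by (simp add: Fract_conv_to_fract)
    then show ?thesis by (metis rangeI)
  next
    case False
    then have "to_fract d * b \<in> range to_fract"
      using d(2) that by simp
    then obtain r where r: "to_fract d * b = to_fract r"
      by (rule rangeE)
    have "to_fract (d * y) * b = (to_fract d * b) * to_fract y"
      by (simp add: mult_ac)
    also have "\<dots> = to_fract (r * y)"
      by (simp add: r)
    finally show ?thesis by (metis rangeI)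
  qed
  then show ?case
    using d(1) a(2) by (intro exI[of _ "d * y"]) simp
qed

text \<open>The case \<open>n = 0\<close> makes \<open>x\<close> a polynomial, and a nonzero
  polynomial is not divisible by a power of eps beyond its degree.\<close>

lemma eps_divisible_imp_zero:
  fixes x :: "'a::field poly fract"
  assumes "\<And>n. \<exists>y\<in>range to_fract. x = ratfun_eps ^ n * y"
  shows "x = 0"
proof -
  have pow: "ratfun_eps ^ n = to_fract ([:0, 1:] ^ n :: 'a poly)" for n
    by (induction n) (simp_all only: power_0 power_Suc to_fract_1 to_fract_mult ratfun_eps_def)
  obtain q where q: "x = to_fract q"
    using assms[of 0] by auto
  have "[:0, 1:] ^ n dvd q" for n
  proof -
    obtain y where "x = to_fract ([:0, 1:] ^ n) * to_fract y"
      using assms[of n] by (auto simp: pow)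
    then have "q = [:0, 1:] ^ n * y"
      unfolding q by (simp flip: to_fract_mult)
    then show ?thesis by simp
  qed
  then have "monom 1 (Suc (degree q)) dvd q"
    by (simp only: monom_altdef smult_1_left)
  then have "q = 0"
    using dvd_imp_degree_le[of "monom 1 (Suc (degree q))" q] by (auto simp: degree_monom_eq)
  then show ?thesis by (simp add: q)
qed

text \<open>After a common denominator is cleared, the coefficients of all \<open>g i\<close> are
  polynomials in eps divisible by every power of eps, hence zero.\<close>

lemma relation_trivial:
  fixes g Q :: "'i \<Rightarrow> 'a::field poly fract mpoly"
  assumes I: "finite I"
    and T: "inj_on T I" "\<And>i a. i \<in> I \<Longrightarrow> Poly_Mapping.lookup (T i) a < p"
    and Q: "\<And>i. i \<in> I \<Longrightarrow> Q i \<in> coeffs_in (range to_fract)"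
    and g: "\<And>i. i \<in> I \<Longrightarrow> g i \<in> pth_exponents p"
    and rel: "(\<Sum>i\<in>I. g i * (Poly_Mapping.single (T i) 1 + const_mpoly ratfun_eps * Q i)) = 0"
    and i: "i \<in> I"
  shows "g i = 0"
proof -
  define A where "A = (\<Union>i\<in>I. Poly_Mapping.lookup (g i) ` Poly_Mapping.keys (g i))"
  have "finite A"
    using I by (simp add: A_def)
  from exists_common_denominator[OF this]
  obtain d where d: "d \<noteq> 0" "\<And>a. a \<in> A \<Longrightarrow> to_fract d * a \<in> range to_fract"
    by metis
  define h where "h i = const_mpoly (to_fract d) * g i" for i
  have h1: "h j \<in> pth_exponents p" if "j \<in> I" for j
    unfolding h_def using g[OF that] const_in_pth_exponents
      domain_subring.mult_mem[OF domain_subring_pth_exponents] by blast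
  have h2: "h j \<in> coeffs_in (range to_fract)" if "j \<in> I" for j
    unfolding coeffs_in_def
  proof (intro CollectI allI)
    fix m
    show "Poly_Mapping.lookup (h j) m \<in> range to_fract"
    proof (cases "m \<in> Poly_Mapping.keys (g j)")
      case True
      then have "Poly_Mapping.lookup (g j) m \<in> A"
        using that by (auto simp: A_def)
      then show ?thesis
        unfolding h_def lookup_const_mult by (rule d(2))
    next
      case False
      then have "Poly_Mapping.lookup (h j) m = 0"
        by (simp add: h_def lookup_const_mult in_keys_iff)
      then show ?thesis
        by (simp only: domain_subring.zero_mem[OF domain_subring_range_to_fract])
    qed
  qed
  have h3: "(\<Sum>i\<in>I. h i * (Poly_Mapping.single (T i) 1 + const_mpoly ratfun_eps * Q i)) = 0"
    unfolding h_def mult.assoc sum_distrib_left[symmetric] rel by simp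
  have eps: "ratfun_eps \<noteq> (0 :: 'a poly fract)"
    by (simp add: ratfun_eps_def)
  have "\<exists>y\<in>range to_fract. Poly_Mapping.lookup (h i) m = ratfun_eps ^ n * y" for m n
    by (rule relation_coeffs_divisible_power[OF I domain_subring_range_to_fract eps T Q h1 h2 h3 i])
  then have "Poly_Mapping.lookup (h i) m = 0" for m
    by (intro eps_divisible_imp_zero)
  then have "Poly_Mapping.lookup (g i) m = 0" for m
    using d(1) by (simp add: h_def lookup_const_mult)
  then show ?thesis
    by (intro poly_mapping_eqI) simp
qed

section \<open>The hard polynomials\<close>

definition set_monom :: "nat set \<Rightarrow> (nat \<Rightarrow>\<^sub>0 nat)" where
  "set_monom A = (\<Sum>a\<in>A. Poly_Mapping.single a 1)"

lemma lookup_set_monom: "finite A \<Longrightarrow> Poly_Mapping.lookup (set_monom A) a = (if a \<in> A then 1 else 0)"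
  by (simp add: set_monom_def lookup_sum lookup_single when_def)

lemma lookup_map_hom: "h 0 = 0 \<Longrightarrow> Poly_Mapping.lookup (Poly_Mapping.map h q) m = h (Poly_Mapping.lookup q m)"
  by (simp add: Poly_Mapping.map.rep_eq when_def)

lemma embed_base_sum_monom:
  fixes M :: "'i \<Rightarrow> nat \<Rightarrow>\<^sub>0 nat"
  shows "embed_base (\<Sum>i\<in>I. Poly_Mapping.single (M i) 1 :: 'a::field mpoly) = (\<Sum>i\<in>I. Poly_Mapping.single (M i) 1)"
proof (rule poly_mapping_eqI)
  fix m
  have add: "to_fract [:a + b:] = to_fract [:a:] + to_fract [:b :: 'a:]" for a b
    by (simp flip: to_fract_add)
  have hom: "to_fract [:\<Sum>i\<in>J. f i:] = (\<Sum>i\<in>J. to_fract [:f i:])" for J and f :: "'i \<Rightarrow> 'a"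
    by (induction J rule: infinite_finite_induct) (simp_all add: add)
  let ?s = "\<lambda>i. Poly_Mapping.single (M i) (1::'a)"
  have "Poly_Mapping.lookup (embed_base (\<Sum>i\<in>I. ?s i)) m = to_fract [:\<Sum>i\<in>I. Poly_Mapping.lookup (?s i) m:]"
    by (simp add: embed_base_def lookup_map_hom lookup_sum)
  also have "\<dots> = (\<Sum>i\<in>I. to_fract [:Poly_Mapping.lookup (?s i) m:])"
    by (rule hom)
  also have "\<dots> = (\<Sum>i\<in>I. Poly_Mapping.lookup (Poly_Mapping.single (M i) 1) m)"
    by (intro sum.cong) (auto simp: lookup_single when_def simp flip: one_pCons)
  finally show "Poly_Mapping.lookup (embed_base (\<Sum>i\<in>I. ?s i)) m
      = Poly_Mapping.lookup (\<Sum>i\<in>I. Poly_Mapping.single (M i) 1) m"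
    by (simp add: lookup_sum)
qed

lemma embed_eps_in_coeffs_in: "embed_eps Q \<in> coeffs_in (range to_fract)"
  by (simp add: embed_eps_def coeffs_in_def lookup_map_hom)

text \<open>The substitution kills every variable outside \<open>Y\<close> except z and z'. The
  assumptions \<open>i \<noteq> z'\<close> and \<open>j \<noteq> z\<close> exclude a match with
  exchanged roles.\<close>

lemma coeff2_monom_value_hard:
  fixes Y :: "nat set"
  assumes "z \<notin> Y" "z' \<notin> Y" "z \<noteq> z'" "i \<notin> Y" "j \<notin> Y" "i \<noteq> z'" "j \<noteq> z" "A \<subseteq> Y" "finite Y"
  shows "coeff2 (monom_value (jet_var Y z z') (Poly_Mapping.single i 1 + Poly_Mapping.single j 1 + set_monom A)) 1 1
    = (if i = z \<and> j = z' then Poly_Mapping.single (set_monom A) 1 else 0 :: 'b::comm_ring_1 mpoly)"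
proof -
  have "(\<Prod>a\<in>A. jet_var Y z z' a) = [:[:Poly_Mapping.single (set_monom A) 1 :: 'b mpoly:]:]"
    if "finite A" "A \<subseteq> Y" for A
    using that
  proof (induction A rule: finite_induct)
    case empty
    then show ?case by (simp add: set_monom_def one_pCons)
  next
    case (insert a A)
    then have "jet_var Y z z' a = [:[:yvar a :: 'b mpoly:]:]"
      using assms by (auto simp: jet_var_def)
    with insert show ?case
      by (simp add: set_monom_def yvar_def mult_single)
  qed
  then have *: "(\<Prod>a\<in>A. jet_var Y z z' a) = [:[:Poly_Mapping.single (set_monom A) 1 :: 'b mpoly:]:]"
    using assms finite_subset by blast
  have "monom_value (jet_var Y z z') (Poly_Mapping.single i 1 + Poly_Mapping.single j 1 + set_monom A)
    = jet_var Y z z' i * jet_var Y z z' j * [:[:Poly_Mapping.single (set_monom A) 1 :: 'b mpoly:]:]"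
    unfolding *[symmetric] by (simp add: set_monom_def monom_value_add monom_value_sum)
  moreover have "jet_var Y z z' i = (if i = z then [:0, 1:] else 0 :: 'b mpoly poly poly)"
    "jet_var Y z z' j = (if j = z' then [:[:0, 1:]:] else 0 :: 'b mpoly poly poly)"
    using assms(4-7) by (simp_all add: jet_var_def)
  ultimately show ?thesis
    by simp
qed

lemma CHAR_fract: "CHAR('b::idom fract) = CHAR('b)"
proof (rule CHAR_eqI)
  have of_nat: "of_nat n = to_fract (of_nat n :: 'b)" for n
    by (induction n) simp_all
  show "of_nat CHAR('b) = (0 :: 'b fract)"
    by (simp add: of_nat)
  show "CHAR('b) dvd n" if "of_nat n = (0 :: 'b fract)" for n
    using that by (simp add: of_nat of_nat_eq_0_iff_char_dvd)
qed

text \<open>The coefficients at the \<open>w\<^sup>2\<close> pairs are compared in two ways. For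
  small \<open>k\<close> the sum of products forces a nontrivial relation among them, whereas the
  form of \<open>f\<close> permits only the trivial one.\<close>

lemma exists_hard_mpoly:
  assumes p: "prime p" "CHAR('a::field) = p" and w: "2 * w + v \<le> n" "w\<^sup>2 \<le> 2 ^ v"
  shows "\<exists>f :: 'a mpoly. f \<in> mpolys n \<and>
    (\<forall>k. f \<in> border_SPS k n \<longrightarrow> w\<^sup>2 \<le> k * (v + 1) ^ (2 * (p - 1)))"
proof -
  \<comment> \<open>Indices up to \<open>w\<close> belong to the z_i, the next \<open>w\<close> to
    the z'_j, and the next \<open>v\<close> to the y variables.\<close>
  define Y where "Y = {2 * w + 1..2 * w + v}"
  define I where "I = {1..w} \<times> {w + 1..2 * w}"
  have Y: "finite Y" "card Y = v" and I: "finite I" "card I = w\<^sup>2"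
    by (simp_all add: Y_def I_def card_cartesian_product power2_eq_square)
  have "card I \<le> card (Pow Y)"
    using Y I w(2) by (simp add: card_Pow)
  \<comment> \<open>The bound \<open>w\<^sup>2 \<le> 2 ^ v\<close> leaves enough subsets of
    \<open>Y\<close> to give each pair its own multilinear monomial.\<close>
  then obtain A where A: "A ` I \<subseteq> Pow Y" "inj_on A I"
    using card_le_inj[OF I(1), of "Pow Y"] Y(1) by auto
  have AY: "A r \<subseteq> Y" if "r \<in> I" for r
    using A(1) that by blast
  have finA: "finite (A r)" if "r \<in> I" for r
    using AY[OF that] Y(1) finite_subset by blast
  define M where "M r = Poly_Mapping.single (fst r) 1 + Poly_Mapping.single (snd r) 1 + set_monom (A r)" for r
  define f where "f = (\<Sum>r\<in>I. Poly_Mapping.single (M r) (1 :: 'a))"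
  have rI: "fst r \<notin> Y" "snd r \<notin> Y" "fst r \<in> {1..n}" "snd r \<in> {1..n}" if "r \<in> I" for r
    using that w(1) by (auto simp: Y_def I_def)
  have rI': "fst r \<noteq> snd t" if "r \<in> I" "t \<in> I" for r t
    using that by (auto simp: I_def)
  have "f \<in> mpolys n"
  proof -
    have "Poly_Mapping.keys (M r) \<subseteq> {1..n}" if r: "r \<in> I" for r
    proof -
      have "A r \<subseteq> {1..n}"
        using AY[OF r] w(1) by (auto simp: Y_def)
      then show ?thesis
        using rI(3,4)[OF r] finA[OF r]
        by (auto simp: M_def in_keys_iff lookup_add lookup_single when_def lookup_set_monom split: if_splits)
    qed
    moreover have "\<exists>r\<in>I. m = M r" if "m \<in> Poly_Mapping.keys f" for m
    proof (rule ccontr)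
      assume "\<not> ?thesis"
      then have "Poly_Mapping.lookup f m = 0"
        by (auto simp: f_def lookup_sum lookup_single when_def intro!: sum.neutral)
      with that show False
        by (simp add: in_keys_iff)
    qed
    ultimately show ?thesis
      unfolding mpolys_def by blast
  qed
  moreover have "w\<^sup>2 \<le> k * (v + 1) ^ (2 * (p - 1))" if border: "f \<in> border_SPS k n" for k
  proof (rule ccontr)
    assume less: "\<not> ?thesis"
    obtain m :: "nat \<Rightarrow> nat" and l c N Q where
      l: "\<forall>i\<in>{1..k}. \<forall>j\<in>{1..m i}. l i j \<in> affine_mpolys n" and
      eq: "(\<Sum>i=1..k. const_mpoly (c i) * (\<Prod>j=1..m i. l i j)) =
         const_mpoly (ratfun_eps ^ N) * embed_base f + const_mpoly (ratfun_eps ^ (N + 1)) * embed_eps Q"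
      using border unfolding border_SPS_def mem_Collect_eq by blast
    have char: "CHAR('a poly fract) = p"
      using p(2) by (simp add: CHAR_fract)
    interpret domain_subring "pth_exponents p :: 'a poly fract mpoly set"
      by (rule domain_subring_pth_exponents)
    define V where "V r = coeff2 (jet Y (fst r) (snd r) (const_mpoly (ratfun_eps ^ N) * embed_base f
      + const_mpoly (ratfun_eps ^ (N + 1)) * embed_eps Q)) 1 1" for r
    from depth3_jets_in_fspan[where k = k and m = m and l = l and n = n and c = c, OF p(1) char Y(1) l]
    obtain U where U: "finite U" "card U \<le> k * (card Y + 1) ^ (2 * (p - 1))"
      "\<forall>z z'. z \<notin> Y \<longrightarrow> z' \<notin> Y \<longrightarrow> z \<noteq> z' \<longrightarrow>
        coeff2 (jet Y z z' (\<Sum>i=1..k. const_mpoly (c i) * (\<Prod>j=1..m i. l i j))) 1 1 \<in> fspan U"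
      by (elim exE conjE) (rule that)
    \<comment> \<open>First evaluation of \<open>V r\<close>, through the sum of products.\<close>
    have V_span: "V r \<in> fspan U" if "r \<in> I" for r
      unfolding V_def eq[symmetric] using that by (intro U(3)[rule_format] rI rI')
    have "card U < card I"
      using less U(2) Y(2) I(2) by simp
    then have "\<exists>g. (\<forall>r\<in>I. g r \<in> pth_exponents p) \<and> (\<exists>r\<in>I. g r \<noteq> 0) \<and> (\<Sum>r\<in>I. g r * V r) = 0"
      using V_span by (rule exists_dependence[OF U(1) I(1)])
    then obtain g where g: "\<forall>r\<in>I. g r \<in> pth_exponents p" "\<exists>r\<in>I. g r \<noteq> 0" "(\<Sum>r\<in>I. g r * V r) = 0"
      by (elim exE conjE) (rule that)
    define q where "q r = coeff2 (jet Y (fst r) (snd r) (embed_eps Q)) 1 1" for r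
    \<comment> \<open>Second evaluation, through \<open>f\<close>: the terms of all other pairs
      vanish, and the error term contributes one extra factor eps.\<close>
    have V: "V r = const_mpoly (ratfun_eps ^ N) *
        (Poly_Mapping.single (set_monom (A r)) 1 + const_mpoly ratfun_eps * q r)" if r: "r \<in> I" for r
    proof -
      have "coeff2 (jet Y (fst r) (snd r) (embed_base f)) 1 1 =
        (\<Sum>t\<in>I. coeff2 (monom_value (jet_var Y (fst r) (snd r)) (M t)) 1 1)"
        unfolding f_def embed_base_sum_monom jet_hom coeff_sum coeff2_jet_const_mult by simp
      also have "\<dots> = (\<Sum>t\<in>I. if t = r then Poly_Mapping.single (set_monom (A r)) 1 else 0)"
      proof (intro sum.cong refl)
        fix t
        assume t: "t \<in> I"
        show "coeff2 (monom_value (jet_var Y (fst r) (snd r)) (M t)) 1 1 =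
          (if t = r then Poly_Mapping.single (set_monom (A r)) 1 else 0 :: 'a poly fract mpoly)"
          unfolding M_def coeff2_monom_value_hard[OF rI(1,2)[OF r] rI'[OF r r] rI(1,2)[OF t] rI'[OF t r]
              rI'[OF r t, symmetric] AY[OF t] Y(1)]
          by (simp flip: prod_eq_iff)
      qed
      also have "\<dots> = Poly_Mapping.single (set_monom (A r)) 1"
        using r I(1) by simp
      finally show ?thesis
        by (simp add: V_def q_def jet_hom coeff2_jet_const_mult const_mpoly_mult distrib_left mult_ac)
    qed
    have "const_mpoly (ratfun_eps ^ N) *
        (\<Sum>r\<in>I. g r * (Poly_Mapping.single (set_monom (A r)) 1 + const_mpoly ratfun_eps * q r)) = (\<Sum>r\<in>I. g r * V r)"
      unfolding sum_distrib_left by (intro sum.cong refl) (simp add: V mult.left_commute)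
    then have "const_mpoly (ratfun_eps ^ N) *
        (\<Sum>r\<in>I. g r * (Poly_Mapping.single (set_monom (A r)) 1 + const_mpoly ratfun_eps * q r)) = 0"
      using g(3) by simp
    moreover have "const_mpoly (ratfun_eps ^ N :: 'a poly fract) \<noteq> 0"
    proof -
      have "Poly_Mapping.lookup (const_mpoly (ratfun_eps ^ N :: 'a poly fract)) 0 = ratfun_eps ^ N"
        by (simp add: const_mpoly_def)
      moreover have "ratfun_eps ^ N \<noteq> (0 :: 'a poly fract)"
        by (simp add: ratfun_eps_def)
      ultimately show ?thesis
        by auto
    qed
    ultimately have rel: "(\<Sum>r\<in>I. g r * (Poly_Mapping.single (set_monom (A r)) 1 + const_mpoly ratfun_eps * q r)) = 0"
      by (simp only: mult_eq_0_iff simp_thms)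
    have inj: "inj_on (\<lambda>r. set_monom (A r)) I"
    proof (rule inj_onI)
      fix r t
      assume rt: "r \<in> I" "t \<in> I" "set_monom (A r) = set_monom (A t)"
      have "a \<in> A r \<longleftrightarrow> a \<in> A t" for a
      proof -
        have "(if a \<in> A r then 1 else 0 :: nat) = (if a \<in> A t then 1 else 0)"
          by (simp only: lookup_set_monom[OF finA[OF rt(1)], symmetric]
              lookup_set_monom[OF finA[OF rt(2)], symmetric] rt(3))
        then show ?thesis by (simp split: if_splits)
      qed
      then have "A r = A t" by blast
      then show "r = t"
        by (rule inj_onD[OF A(2) _ rt(1,2)])
    qed
    \<comment> \<open>Exponents are at most 1, which is below the prime \<open>p\<close>.\<close>
    have small: "Poly_Mapping.lookup (set_monom (A r)) a < p" if "r \<in> I" for r a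
      using prime_gt_1_nat[OF p(1)] by (simp add: lookup_set_monom[OF finA[OF that]])
    have q: "q r \<in> coeffs_in (range to_fract)" for r
      unfolding q_def by (intro coeff2_jet_in_coeffs_in domain_subring_range_to_fract embed_eps_in_coeffs_in)
    have "g r = 0" if "r \<in> I" for r
      by (rule relation_trivial[where Q = q, OF I(1) inj small q bspec[OF g(1)] rel that])
    with g(2) show False by blast
  qed
  ultimately show ?thesis by blast
qed

section \<open>Choice of parameters and conclusion\<close>

lemma eventually_parameters:
  "\<forall>\<^sub>F n in sequentially. \<exists>w v. 2 * w + v \<le> n \<and> w\<^sup>2 \<le> 2 ^ v \<and> n * (v + 1) ^ d < w\<^sup>2"
proof -
  \<comment> \<open>Here \<open>u\<close> is the integer part of log_2 n and
    \<open>v = 2 * u\<close>. The constant 64 comes from \<open>n \<le> 8 * w\<close>, that is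
    \<open>n * n \<le> 64 * w\<^sup>2\<close>.\<close>
  have "(\<lambda>u::nat. 64 * (2 * real u + 1) ^ d / 2 ^ u) \<longlonglongrightarrow> 0"
    by real_asymp
  then have "\<forall>\<^sub>F u in sequentially. 64 * (2 * real u + 1) ^ d / 2 ^ u < 1"
    by (rule order_tendstoD) simp
  then obtain u0 where u0: "\<And>u. u \<ge> u0 \<Longrightarrow> 64 * (2 * real u + 1) ^ d / 2 ^ u < 1"
    by (auto simp: eventually_sequentially)
  \<comment> \<open>The 10 added to \<open>u0\<close> ensures \<open>u \<ge> 4\<close>, for
    \<open>4 * u \<le> 2 ^ u\<close>, and \<open>n \<ge> 8\<close>.\<close>
  have "\<exists>w v. 2 * w + v \<le> n \<and> w\<^sup>2 \<le> 2 ^ v \<and> n * (v + 1) ^ d < w\<^sup>2" if n: "n \<ge> 2 ^ (u0 + 10)" for n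
  proof -
    have "n \<ge> 1" using n one_le_power[of "2::nat" "u0 + 10"] by linarith
    then obtain u where u: "2 ^ u \<le> n" "n < 2 ^ (u + 1)"
      using ex_power_ivl1[of 2 n] by auto
    have "(2::nat) ^ (u0 + 10) < 2 ^ (u + 1)"
      using n u(2) by linarith
    then have u_ge: "u \<ge> u0 + 10"
      using power_less_imp_less_exp[of "2::nat" "u0 + 10" "u + 1"] by simp
    \<comment> \<open>About half of the variables go to the pairs; the other half has room for
      \<open>2 * u\<close> variables y.\<close>
    define w where "w = n div 4"
    have "64 * (2 * real u + 1) ^ d < 2 ^ u"
      using u0[of u] u_ge by (simp add: divide_simps)
    then have "real (64 * (2 * u + 1) ^ d) < real (2 ^ u)"
      by (simp add: add.commute)
    then have main: "64 * (2 * u + 1) ^ d < 2 ^ u"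
      by (simp only: of_nat_less_iff)
    have "4 * u \<le> 2 ^ u" if "u \<ge> 4" for u :: nat
      using that by (induction u rule: dec_induct) auto
    from this[of u] have "4 * u \<le> n"
      using u_ge u(1) by simp
    then have "2 * w + 2 * u \<le> n"
      by (simp add: w_def)
    moreover have "w \<le> 2 ^ u"
      using u(2) by (simp add: w_def)
    then have "w\<^sup>2 \<le> 2 ^ (2 * u)"
      using power_mono[of w "2 ^ u" 2] by (simp add: power_even_eq)
    moreover have "n * (2 * u + 1) ^ d < w\<^sup>2"
    proof -
      have "(2::nat) ^ 3 \<le> 2 ^ (u0 + 10)"
        by (rule power_increasing) simp_all
      then have "n \<ge> 8"
        using n by simp
      then have "n \<le> 8 * w"
        by (simp add: w_def)
      then have "n * n \<le> 64 * w\<^sup>2"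
        using mult_mono[of n "8 * w" n "8 * w"] by (simp add: power2_eq_square)
      moreover have "64 * (2 * u + 1) ^ d < n"
        using main u(1) by linarith
      then have "n * (64 * (2 * u + 1) ^ d) < n * n"
        using \<open>n \<ge> 1\<close> by simp
      then have "64 * (n * (2 * u + 1) ^ d) < n * n"
        by (simp only: mult.left_commute)
      ultimately show ?thesis by linarith
    qed
    ultimately show ?thesis by blast
  qed
  then show ?thesis
    unfolding eventually_sequentially by blast
qed

theorem theorem1p3:
  assumes "CHAR('a::field) \<noteq> 0"
  shows "\<exists>f :: nat \<Rightarrow> 'a mpoly.
           (\<forall>n. f n \<in> mpolys n) \<and>
           (\<forall>k :: nat \<Rightarrow> nat. (\<lambda>n. real (k n)) \<in> o(\<lambda>n. real n) \<longrightarrow>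
              (\<forall>\<^sub>F n in sequentially. f n \<notin> border_SPS (k n) n))"
proof -
  define p where "p = CHAR('a)"
  have p: "prime p" "CHAR('a) = p"
    using assms prime_CHAR_semidom[where 'a = 'a] by (auto simp: p_def)
  let ?d = "2 * (p - 1)"
  define good where "good n \<longleftrightarrow> (\<exists>w v. 2 * w + v \<le> n \<and> w\<^sup>2 \<le> 2 ^ v \<and> n * (v + 1) ^ ?d < w\<^sup>2)" for n
  \<comment> \<open>One \<open>f\<close> handles every \<open>k \<le> n\<close> at once, so the
    family can be fixed before the function \<open>k\<close> is given.\<close>
  have "\<exists>f :: 'a mpoly. f \<in> mpolys n \<and> (good n \<longrightarrow> (\<forall>k\<le>n. f \<notin> border_SPS k n))" for n
  proof (cases "good n")
    case True
    then obtain w v where wv: "2 * w + v \<le> n" "w\<^sup>2 \<le> 2 ^ v" "n * (v + 1) ^ ?d < w\<^sup>2"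
      by (auto simp: good_def)
    obtain f :: "'a mpoly" where f: "f \<in> mpolys n"
      "\<And>k. f \<in> border_SPS k n \<Longrightarrow> w\<^sup>2 \<le> k * (v + 1) ^ ?d"
      using exists_hard_mpoly[OF p wv(1,2)] by blast
    have "f \<notin> border_SPS k n" if "k \<le> n" for k
    proof
      assume "f \<in> border_SPS k n"
      then have "w\<^sup>2 \<le> k * (v + 1) ^ ?d"
        by (rule f(2))
      also have "\<dots> \<le> n * (v + 1) ^ ?d"
        using that by (rule mult_le_mono1)
      finally show False
        using wv(3) by simp
    qed
    with f(1) show ?thesis by blast
  next
    \<comment> \<open>The zero polynomial fills the places without suitable parameters, which are
      finitely many.\<close>
    case False
    have "0 \<in> (mpolys n :: 'a mpoly set)"
      by (simp add: mpolys_def)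
    with False show ?thesis by blast
  qed
  then obtain f :: "nat \<Rightarrow> 'a mpoly" where
    f: "\<And>n. f n \<in> mpolys n" "\<And>n k. good n \<Longrightarrow> k \<le> n \<Longrightarrow> f n \<notin> border_SPS k n"
    by metis
  have "\<forall>\<^sub>F n in sequentially. f n \<notin> border_SPS (k n) n"
    if k: "(\<lambda>n. real (k n)) \<in> o(\<lambda>n. real n)" for k
  proof -
    have "\<forall>\<^sub>F n in sequentially. k n \<le> n"
      using landau_o.smallD[OF k, of 1] by simp
    moreover have "\<forall>\<^sub>F n in sequentially. good n"
      unfolding good_def by (rule eventually_parameters)
    ultimately show ?thesis
      by eventually_elim (rule f(2))
  qed
  with f(1) show ?thesis by blast
qed

end
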